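(* Assume the Continuum Hypothesis. Let $B$ be a metrizable separable topological group for which there exist a nonmeager metrizable separable topological group $C$ and a surjective Borel homomorphism $f:C\to B$. Then there is a subspace $X\subset B$ with the property $\bigcup_{fin}(\mathcal O,\mathcal O)$ such that $X$ generates $B$ as a group. In particular (under the Continuum Hypothesis), the group $$\mathsf G=\{x\in\{0,1\}^{\omega\times\omega} : \text{for every } j\in\omega,\ x_{i,j}=0 \text{ for all but finitely many } i\in\omega\}$$ is generated by a subspace of it with the property $\bigcup_{fin}(\mathcal O,\mathcal O)$.
   Context: A map $f$ between topological spaces is Borel if preimages of Borel sets are Borel. A topological group is nonmeager if it is not a meager subset of itself. A topological space $X$ has the property $\bigcup_{fin}(\mathcal O,\mathcal O)$ (the Menger property) if for every sequence $(u_n)_{n\in\omega}$ of open covers of $X$ there exists a sequence $(v_n)_{n\in\omega}$, where each $v_n$ is a finite subset of $u_n$, such that $\bigcup_{n\in\omega}\bigcup v_n=X$. A subset $X$ of a group $B$ generates $B$ if the smallest subgroup of $B$ containing $X$ is $B$. $\{0,1\}^{\omega\times\omega}$ carries the product topology and the group operation of coordinatewise addition modulo $2$; $\mathsf G$ is a subgroup with the subspace topology. *)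

theory Defs
  imports
    "HOL-Analysis.Analysis"
    "HOL-Library.Equipollence"
    "HOL-Algebra.Generated_Groups"
    "HOL-Algebra.Elementary_Groups"
    "HOL-Algebra.Product_Groups"
begin

definition continuum_hypothesis :: bool where
  "continuum_hypothesis \<longleftrightarrow> (\<forall>S :: real set. countable S \<or> S \<approx> (UNIV :: real set))"

definition topological_group :: "('a, 'm) monoid_scheme \<Rightarrow> 'a topology \<Rightarrow> bool" where
  "topological_group G T \<longleftrightarrow>
     group G \<and> topspace T = carrier G \<and>
     continuous_map (prod_topology T T) T (\<lambda>(x, y). x \<otimes>\<^bsub>G\<^esub> y) \<and>
     continuous_map T T (\<lambda>x. inv\<^bsub>G\<^esub> x)"

definition borel_of :: "'a topology \<Rightarrow> 'a measure" where
  "borel_of T = sigma (topspace T) {U. openin T U}"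

definition borel_map :: "'a topology \<Rightarrow> 'b topology \<Rightarrow> ('a \<Rightarrow> 'b) \<Rightarrow> bool" where
  "borel_map S T f \<longleftrightarrow> f \<in> borel_of S \<rightarrow>\<^sub>M borel_of T"

definition nowhere_dense_in :: "'a topology \<Rightarrow> 'a set \<Rightarrow> bool" where
  "nowhere_dense_in T A \<longleftrightarrow> A \<subseteq> topspace T \<and> T interior_of (T closure_of A) = {}"

definition meager_in :: "'a topology \<Rightarrow> 'a set \<Rightarrow> bool" where
  "meager_in T A \<longleftrightarrow>
     (\<exists>\<N>. countable \<N> \<and> (\<forall>N\<in>\<N>. nowhere_dense_in T N) \<and> A = \<Union>\<N>)"

definition open_cover :: "'a topology \<Rightarrow> 'a set set \<Rightarrow> bool" where
  "open_cover T \<U> \<longleftrightarrow> (\<forall>U\<in>\<U>. openin T U) \<and> \<Union>\<U> = topspace T"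

definition Menger_space :: "'a topology \<Rightarrow> bool" where
  "Menger_space T \<longleftrightarrow>
     (\<forall>u :: nat \<Rightarrow> 'a set set. (\<forall>n. open_cover T (u n)) \<longrightarrow>
        (\<exists>v. (\<forall>n. finite (v n) \<and> v n \<subseteq> u n) \<and> (\<Union>n. \<Union>(v n)) = topspace T))"

text \<open>
  The group of all 0-1 matrices indexed by pairs of naturals, with coordinatewise addition
  modulo 2, and its product topology. The entries are the integers 0 and 1, since
  \<^const>\<open>integer_mod_group\<close> is a group on residues of type \<^typ>\<open>int\<close>.
\<close>

definition binary_matrix_group :: "(nat \<times> nat \<Rightarrow> int) monoid" where
  "binary_matrix_group = product_group UNIV (\<lambda>_. integer_mod_group 2)"

definition binary_matrix_topology :: "(nat \<times> nat \<Rightarrow> int) topology" where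
  "binary_matrix_topology = product_topology (\<lambda>_. discrete_topology {0, 1}) UNIV"

definition finite_column_matrices :: "(nat \<times> nat \<Rightarrow> int) set" where
  "finite_column_matrices =
     {x \<in> carrier binary_matrix_group. \<forall>j. finite {i. x (i, j) \<noteq> 0}}"

definition finite_column_group :: "(nat \<times> nat \<Rightarrow> int) monoid" where
  "finite_column_group = binary_matrix_group\<lparr>carrier := finite_column_matrices\<rparr>"

definition finite_column_topology :: "(nat \<times> nat \<Rightarrow> int) topology" where
  "finite_column_topology = subtopology binary_matrix_topology finite_column_matrices"

lemma carrier_integer_mod_group_2: "carrier (integer_mod_group 2) = {0, 1}"
  by (auto simp: carrier_integer_mod_group)

lemma topspace_binary_matrix_topology:
  "topspace binary_matrix_topology = carrier binary_matrix_group"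
  by (simp add: binary_matrix_topology_def binary_matrix_group_def carrier_integer_mod_group_2)

lemma group_binary_matrix_group: "group binary_matrix_group"
  by (simp add: binary_matrix_group_def)

lemma mult_binary_matrix_group:
  "x \<otimes>\<^bsub>binary_matrix_group\<^esub> y = (\<lambda>p. (x p + y p) mod 2)"
  by (simp add: binary_matrix_group_def product_group_def integer_mod_group_def restrict_UNIV)

lemma inv_binary_matrix_group:
  assumes "x \<in> carrier binary_matrix_group"
  shows "inv\<^bsub>binary_matrix_group\<^esub> x = x"
proof -
  interpret group binary_matrix_group by (rule group_binary_matrix_group)
  have "x p = 0 \<or> x p = 1" for p
    using assms by (cases p) (auto simp: binary_matrix_group_def carrier_integer_mod_group_2 PiE_iff)
  then have "(x p + x p) mod 2 = 0" for p
    by auto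
  then have "x \<otimes>\<^bsub>binary_matrix_group\<^esub> x = \<one>\<^bsub>binary_matrix_group\<^esub>"
    by (simp add: mult_binary_matrix_group)
       (simp add: binary_matrix_group_def integer_mod_group_def restrict_UNIV)
  then show ?thesis
    using assms by (intro inv_equality)
qed

lemma subgroup_finite_column_matrices: "subgroup finite_column_matrices binary_matrix_group"
proof -
  interpret group binary_matrix_group by (rule group_binary_matrix_group)
  show ?thesis
  proof
    show "finite_column_matrices \<subseteq> carrier binary_matrix_group"
      by (auto simp: finite_column_matrices_def)
    show "\<one>\<^bsub>binary_matrix_group\<^esub> \<in> finite_column_matrices"
      using one_closed
      by (auto simp: finite_column_matrices_def binary_matrix_group_def integer_mod_group_def)
  next
    fix x y assume x: "x \<in> finite_column_matrices" and y: "y \<in> finite_column_matrices"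
    have "finite {i. (x (i, j) + y (i, j)) mod 2 \<noteq> 0}" for j
      by (rule finite_subset[of _ "{i. x (i, j) \<noteq> 0} \<union> {i. y (i, j) \<noteq> 0}"])
         (use x y in \<open>auto simp: finite_column_matrices_def\<close>)
    moreover have "x \<otimes>\<^bsub>binary_matrix_group\<^esub> y \<in> carrier binary_matrix_group"
      using x y by (auto simp: finite_column_matrices_def)
    ultimately show "x \<otimes>\<^bsub>binary_matrix_group\<^esub> y \<in> finite_column_matrices"
      by (simp add: finite_column_matrices_def mult_binary_matrix_group)
  next
    fix x assume "x \<in> finite_column_matrices"
    then show "inv\<^bsub>binary_matrix_group\<^esub> x \<in> finite_column_matrices"
      using inv_binary_matrix_group by (simp add: finite_column_matrices_def)
  qed
qed

end

theory Submission
  imports Defs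
begin

text \<open>Under the Continuum Hypothesis, list the elements and the closed nowhere dense subsets of
  \<open>C\<close> in type \<open>\<omega>\<^sub>1\<close>. At stage \<open>a\<close> write the \<open>a\<close>-th element as a product of two factors that both
  avoid all closed nowhere dense sets listed so far, which is possible because inversion and
  translation preserve meagerness and \<open>C\<close> is nonmeager. The factors form a Luzin set generating \<open>C\<close>.
  A Borel map is continuous on a comeager set, which contains all but countably many points of the
  Luzin set, so the image of the Luzin set has the Menger property, and it generates \<open>B\<close>.\<close>

section \<open>Meager sets\<close>

lemma nowhere_dense_in_subset:
  assumes "nowhere_dense_in T A" "B \<subseteq> A"
  shows "nowhere_dense_in T B"
proof -
  have "T interior_of (T closure_of B) \<subseteq> T interior_of (T closure_of A)"
    by (intro interior_of_mono closure_of_mono assms(2))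
  then show ?thesis
    using assms by (auto simp: nowhere_dense_in_def)
qed

lemma nowhere_dense_in_empty: "nowhere_dense_in T {}"
  by (simp add: nowhere_dense_in_def)

lemma nowhere_dense_in_closure:
  "nowhere_dense_in T A \<Longrightarrow> nowhere_dense_in T (T closure_of A)"
  by (simp add: nowhere_dense_in_def closure_of_subset_topspace)

lemma nowhere_dense_in_homeomorphic_image:
  assumes "homeomorphic_map S T h" "nowhere_dense_in S A"
  shows "nowhere_dense_in T (h ` A)"
proof -
  have A: "A \<subseteq> topspace S" and int: "S interior_of (S closure_of A) = {}"
    using assms(2) by (auto simp: nowhere_dense_in_def)
  have "T interior_of (T closure_of (h ` A)) = h ` (S interior_of (S closure_of A))"
    by (simp add: homeomorphic_map_closure_of[OF assms(1) A]
        homeomorphic_map_interior_of[OF assms(1) closure_of_subset_topspace])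
  moreover have "h ` A \<subseteq> topspace T"
    using A homeomorphic_imp_surjective_map[OF assms(1)] by blast
  ultimately show ?thesis
    by (simp add: nowhere_dense_in_def int)
qed

text \<open>An open set inside \<open>T closure_of Q - U\<close> misses \<open>Q\<close>, because
  \<open>Q \<subseteq> U\<close>, and therefore misses the closure of \<open>Q\<close>, in which it
  lies; so it is empty.\<close>

lemma nowhere_dense_in_closure_minus_open:
  assumes "openin T U" "Q \<subseteq> U"
  shows "nowhere_dense_in T (T closure_of Q - U)"
proof -
  let ?F = "T closure_of Q - U"
  have cl: "closedin T ?F"
    using assms(1) by (simp add: closedin_diff)
  have "T interior_of ?F \<inter> Q = {}"
    using interior_of_subset[of T ?F] assms(2) by blast
  then have "T interior_of ?F \<inter> T closure_of Q = {}"
    by (subst openin_Int_closure_of_eq_empty) simp_all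
  then have "T interior_of ?F = {}"
    using interior_of_subset[of T ?F] by blast
  then show ?thesis
    using cl by (simp add: nowhere_dense_in_def closure_of_closedin closedin_subset)
qed

lemma nowhere_dense_in_closure_minus_self:
  assumes "openin T U"
  shows "nowhere_dense_in T (T closure_of U - U)"
  using nowhere_dense_in_closure_minus_open[OF assms order_refl] .

lemma meager_in_countable_Union:
  "countable \<N> \<Longrightarrow> (\<And>N. N \<in> \<N> \<Longrightarrow> nowhere_dense_in T N) \<Longrightarrow> meager_in T (\<Union>\<N>)"
  unfolding meager_in_def by blast

lemma nowhere_dense_imp_meager_in: "nowhere_dense_in T A \<Longrightarrow> meager_in T A"
  using meager_in_countable_Union[of "{A}"] by simp

lemma meager_in_subset:
  assumes "meager_in T A" "B \<subseteq> A"
  shows "meager_in T B"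
proof -
  obtain \<N> where \<N>: "countable \<N>" "\<And>N. N \<in> \<N> \<Longrightarrow> nowhere_dense_in T N" "A = \<Union>\<N>"
    using assms(1) by (auto simp: meager_in_def)
  have "meager_in T (\<Union>((\<inter>) B ` \<N>))"
    using \<N> by (intro meager_in_countable_Union) (auto intro: nowhere_dense_in_subset)
  moreover have "\<Union>((\<inter>) B ` \<N>) = B"
    using assms(2) \<N>(3) by blast
  ultimately show ?thesis
    by simp
qed

lemma meager_in_UN:
  assumes "countable I" "\<And>i. i \<in> I \<Longrightarrow> meager_in T (A i)"
  shows "meager_in T (\<Union>i\<in>I. A i)"
proof -
  have "\<forall>i\<in>I. \<exists>\<N>. countable \<N> \<and> (\<forall>N\<in>\<N>. nowhere_dense_in T N) \<and> A i = \<Union>\<N>"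
    using assms(2) by (auto simp: meager_in_def)
  then obtain \<N> where \<N>: "\<And>i. i \<in> I \<Longrightarrow> countable (\<N> i)"
      "\<And>i N. i \<in> I \<Longrightarrow> N \<in> \<N> i \<Longrightarrow> nowhere_dense_in T N" "\<And>i. i \<in> I \<Longrightarrow> A i = \<Union>(\<N> i)"
    by metis
  have "meager_in T (\<Union>(\<Union>(\<N> ` I)))"
    using \<N> assms(1) by (intro meager_in_countable_Union) auto
  moreover have "\<Union>(\<Union>(\<N> ` I)) = (\<Union>i\<in>I. A i)"
    using \<N>(3) by auto
  ultimately show ?thesis
    by simp
qed

lemma meager_in_Un: "meager_in T A \<Longrightarrow> meager_in T B \<Longrightarrow> meager_in T (A \<union> B)"
  using meager_in_UN[of "{A, B}" T "\<lambda>X. X"] by auto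

lemma meager_in_homeomorphic_image:
  assumes "homeomorphic_map S T h" "meager_in S A"
  shows "meager_in T (h ` A)"
proof -
  obtain \<N> where \<N>: "countable \<N>" "\<And>N. N \<in> \<N> \<Longrightarrow> nowhere_dense_in S N" "A = \<Union>\<N>"
    using assms(2) by (auto simp: meager_in_def)
  have "meager_in T (\<Union>((`) h ` \<N>))"
    using \<N> assms(1) by (intro meager_in_countable_Union)
      (auto intro: nowhere_dense_in_homeomorphic_image)
  moreover have "\<Union>((`) h ` \<N>) = h ` A"
    using \<N>(3) by blast
  ultimately show ?thesis
    by simp
qed

lemma completely_metrizable_nonmeager:
  assumes "completely_metrizable_space T" "topspace T \<noteq> {}"
  shows "\<not> meager_in T (topspace T)"
proof
  assume "meager_in T (topspace T)"
  then obtain \<N> where \<N>: "countable \<N>" "\<And>N. N \<in> \<N> \<Longrightarrow> nowhere_dense_in T N" "topspace T = \<Union>\<N>"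
    by (auto simp: meager_in_def)
  \<comment> \<open>The Baire category theorem speaks of closed sets, so every member of
    \<open>\<N>\<close> is replaced by its closure, which still has empty interior.\<close>
  have "T interior_of \<Union>((closure_of) T ` \<N>) = {}"
    using \<N> assms(1) by (intro Baire_category_alt) (auto simp: nowhere_dense_in_def)
  moreover have "\<Union>((closure_of) T ` \<N>) = topspace T"
  proof
    show "\<Union>((closure_of) T ` \<N>) \<subseteq> topspace T"
      by (auto simp: in_closure_of)
    show "topspace T \<subseteq> \<Union>((closure_of) T ` \<N>)"
    proof
      fix x assume "x \<in> topspace T"
      then obtain N where "N \<in> \<N>" "x \<in> N"
        using \<N>(3) by blast
      moreover have "N \<subseteq> T closure_of N"
        using \<N>(2)[OF \<open>N \<in> \<N>\<close>] by (simp add: nowhere_dense_in_def closure_of_subset)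
      ultimately show "x \<in> \<Union>((closure_of) T ` \<N>)"
        by blast
    qed
  qed
  ultimately show False
    using assms(2) by simp
qed

section \<open>Borel sets and Borel maps up to meager sets\<close>

text \<open>Every Borel set has the Baire property. Open sets have it with error \<open>{}\<close>,
  and countable unions accumulate only countably many meager errors; complements need a change of
  the open set.\<close>

lemma sigma_sets_Baire_property:
  assumes "A \<in> sigma_sets (topspace T) {U. openin T U}"
  shows "\<exists>U. openin T U \<and> meager_in T (sym_diff A U)"
  using assms
proof (induction rule: sigma_sets.induct)
  case (Basic A)
  then show ?case
    using nowhere_dense_imp_meager_in[OF nowhere_dense_in_empty] by (intro exI[of _ A]) auto
next
  case Empty
  show ?case
    using nowhere_dense_imp_meager_in[OF nowhere_dense_in_empty] by (intro exI[of _ "{}"]) auto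
next
  case (Compl A)
  then obtain U where U: "openin T U" "meager_in T (sym_diff A U)"
    by blast
  \<comment> \<open>The complement of \<open>U\<close> need not be open. The exterior of
    \<open>U\<close> is, and passing to it costs only the nowhere dense boundary
    \<open>T closure_of U - U\<close>.\<close>
  let ?V = "topspace T - T closure_of U"
  have "meager_in T (sym_diff A U \<union> (T closure_of U - U))"
    by (rule meager_in_Un[OF U(2)
          nowhere_dense_imp_meager_in[OF nowhere_dense_in_closure_minus_self[OF U(1)]]])
  moreover have "sym_diff (topspace T - A) ?V \<subseteq> sym_diff A U \<union> (T closure_of U - U)"
    using closure_of_subset[OF openin_subset[OF U(1)]] by blast
  moreover have "openin T ?V"
    by (simp add: openin_diff)
  ultimately show ?case
    using meager_in_subset by blast
next
  case (Union A)
  then obtain U where U: "\<And>i. openin T (U i)" "\<And>i. meager_in T (sym_diff (A i) (U i))"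
    by metis
  have "meager_in T (\<Union>i\<in>UNIV. sym_diff (A i) (U i))"
    by (rule meager_in_UN) (auto intro: U)
  then have "meager_in T (sym_diff (\<Union>i. A i) (\<Union>i. U i))"
    by (rule meager_in_subset) blast
  moreover have "openin T (\<Union>i. U i)"
    using U(1) by blast
  ultimately show ?case
    by blast
qed

lemma borel_of_simps:
  "space (borel_of T) = topspace T"
  "sets (borel_of T) = sigma_sets (topspace T) {U. openin T U}"
proof -
  have "{U. openin T U} \<subseteq> Pow (topspace T)"
    by (auto dest: openin_subset)
  then show "space (borel_of T) = topspace T"
    "sets (borel_of T) = sigma_sets (topspace T) {U. openin T U}"
    by (simp_all add: borel_of_def space_measure_of sets_measure_of)
qed

lemma borel_map_vimage:
  assumes "borel_map S T f" "openin T U"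
  shows "{x \<in> topspace S. f x \<in> U} \<in> sigma_sets (topspace S) {U. openin S U}"
proof -
  have "f -` U \<inter> space (borel_of S) \<in> sets (borel_of S)"
    using assms by (intro measurable_sets[of f _ "borel_of T"])
      (auto simp: borel_map_def borel_of_simps)
  then show ?thesis
    by (simp add: borel_of_simps vimage_def Int_def conj_commute)
qed

lemma borel_map_topspace:
  assumes "borel_map S T f" "x \<in> topspace S"
  shows "f x \<in> topspace T"
  using measurable_space[of f "borel_of S" "borel_of T" x] assms
  by (simp add: borel_map_def borel_of_simps)

lemma continuous_map_imp_borel_map:
  assumes "continuous_map S T f"
  shows "borel_map S T f"
  unfolding borel_map_def
proof (rule measurable_sigma_sets[of _ "topspace T" "{U. openin T U}"])
  show "f \<in> space (borel_of S) \<rightarrow> topspace T"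
    using assms by (auto simp: borel_of_simps continuous_map_def)
  fix U assume "U \<in> {U. openin T U}"
  then have "openin S {x \<in> topspace S. f x \<in> U}"
    using assms by (simp add: continuous_map_def)
  moreover have "f -` U \<inter> space (borel_of S) = {x \<in> topspace S. f x \<in> U}"
    by (auto simp: borel_of_simps)
  ultimately show "f -` U \<inter> space (borel_of S) \<in> sets (borel_of S)"
    by (simp add: borel_of_simps)
qed (auto simp: borel_of_simps dest: openin_subset)

text \<open>The preimage of each basic open \<open>V\<close> agrees with an open set
  \<open>W V\<close> up to a meager set. A countable base leaves a meager union \<open>M\<close> of
  these errors, and off \<open>M\<close> the preimage of \<open>V\<close> is exactly the trace of
  \<open>W V\<close>.\<close>

lemma borel_map_continuous_on_comeager:
  assumes f: "borel_map S T f" and T: "second_countable T"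
  obtains D where "D \<subseteq> topspace S" "meager_in S (topspace S - D)"
    "continuous_map (subtopology S D) T f"
proof -
  obtain \<B> where \<B>: "countable \<B>" "\<And>V. V \<in> \<B> \<Longrightarrow> openin T V"
    and base: "\<And>U x. openin T U \<Longrightarrow> x \<in> U \<Longrightarrow> \<exists>V\<in>\<B>. x \<in> V \<and> V \<subseteq> U"
    using T unfolding second_countable_def by metis
  have "\<forall>V\<in>\<B>. \<exists>W. openin S W \<and> meager_in S (sym_diff {x \<in> topspace S. f x \<in> V} W)"
    using sigma_sets_Baire_property[OF borel_map_vimage[OF f]] \<B>(2) by blast
  from bchoice[OF this] obtain W where W: "\<And>V. V \<in> \<B> \<Longrightarrow> openin S (W V)"
      "\<And>V. V \<in> \<B> \<Longrightarrow> meager_in S (sym_diff {x \<in> topspace S. f x \<in> V} (W V))"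
    by blast
  define M where "M = (\<Union>V\<in>\<B>. sym_diff {x \<in> topspace S. f x \<in> V} (W V))"
  have "meager_in S M"
    unfolding M_def using W \<B>(1) by (intro meager_in_UN) auto
  show ?thesis
  proof
    show "topspace S - M \<subseteq> topspace S"
      by blast
    show "meager_in S (topspace S - (topspace S - M))"
      using \<open>meager_in S M\<close> by (rule meager_in_subset) blast
    show "continuous_map (subtopology S (topspace S - M)) T f"
      unfolding continuous_map_def
    proof (intro conjI allI impI)
      show "f \<in> topspace (subtopology S (topspace S - M)) \<rightarrow> topspace T"
        using borel_map_topspace[OF f] by auto
      fix U assume U: "openin T U"
      have "\<exists>G. openin (subtopology S (topspace S - M)) G \<and> x \<in> G \<and>
          G \<subseteq> {x \<in> topspace (subtopology S (topspace S - M)). f x \<in> U}"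
        if x: "x \<in> topspace S - M" "f x \<in> U" for x
      proof -
        obtain V where V: "V \<in> \<B>" "f x \<in> V" "V \<subseteq> U"
          using base[OF U x(2)] by blast
        have *: "y \<in> W V \<longleftrightarrow> f y \<in> V" if "y \<in> topspace S - M" for y
          using that V(1) unfolding M_def by blast
        show ?thesis
        proof (intro exI conjI)
          show "openin (subtopology S (topspace S - M)) ((topspace S - M) \<inter> W V)"
            by (rule openin_subtopology_Int2[OF W(1)[OF V(1)]])
          show "x \<in> (topspace S - M) \<inter> W V"
            using x(1) V(2) * by blast
          show "(topspace S - M) \<inter> W V \<subseteq> {x \<in> topspace (subtopology S (topspace S - M)). f x \<in> U}"
            using V(3) * by auto
        qed
      qed
      then show "openin (subtopology S (topspace S - M))
          {x \<in> topspace (subtopology S (topspace S - M)). f x \<in> U}"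
        by (subst openin_subopen) auto
    qed
  qed
qed

section \<open>Menger images of Luzin sets\<close>

lemma metrizable_separable_imp_second_countable:
  assumes "metrizable_space T" "separable_space T"
  shows "second_countable T"
proof -
  obtain M d where "Metric_space M d" and T: "T = Metric_space.mtopology M d"
    using assms(1) by (auto simp: metrizable_space_def)
  interpret Metric_space M d by fact
  obtain Q where Q: "countable Q" "Q \<subseteq> M" "mtopology closure_of Q = M"
    using assms(2) by (auto simp: separable_space_def T)
  define \<B> where "\<B> = (\<lambda>(q, n). mball q (1 / real (Suc n))) ` (Q \<times> UNIV)"
  have "\<exists>V\<in>\<B>. x \<in> V \<and> V \<subseteq> U" if U: "openin mtopology U" and x: "x \<in> U" for U x
  proof -
    obtain r where r: "r > 0" "mball x r \<subseteq> U" and xM: "x \<in> M"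
      using U x unfolding openin_mtopology by blast
    \<comment> \<open>Half of \<open>r\<close> pays for the distance from \<open>x\<close> to the
      centre \<open>q\<close>, the other half for the radius of the ball around
      \<open>q\<close>.\<close>
    obtain n where n: "1 / real (Suc n) < r / 2"
      using r(1) by (meson half_gt_zero nat_approx_posE)
    have "x \<in> mtopology closure_of Q"
      using Q(3) xM by simp
    then obtain q where q: "q \<in> Q" "q \<in> mball x (1 / real (Suc n))"
      unfolding metric_closure_of by auto (metis of_nat_0_less_iff of_nat_Suc zero_less_Suc zero_less_divide_1_iff)
    have qx: "q \<in> M" "d x q < 1 / real (Suc n)"
      using q(2) by (auto simp: in_mball)
    have "mball q (1 / real (Suc n)) \<subseteq> mball x r"
    proof
      fix y assume y: "y \<in> mball q (1 / real (Suc n))"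
      then have "d x y \<le> d x q + d q y"
        using xM qx(1) by (intro triangle) (auto simp: in_mball)
      then show "y \<in> mball x r"
        using y n qx xM by (simp add: in_mball)
    qed
    moreover have "x \<in> mball q (1 / real (Suc n))"
      using qx xM by (simp add: in_mball commute)
    moreover have "mball q (1 / real (Suc n)) \<in> \<B>"
      unfolding \<B>_def using q(1) by (intro image_eqI[of _ _ "(q, n)"]) auto
    ultimately show ?thesis
      using r(2) by blast
  qed
  moreover have "countable \<B>" "\<forall>V\<in>\<B>. openin mtopology V"
    using Q(1) by (auto simp: \<B>_def)
  ultimately show ?thesis
    unfolding second_countable_def T by blast
qed

lemma countable_subset_covered:
  assumes "\<And>n::nat. open_cover T (u n)" "countable E" "E \<subseteq> topspace T"
  shows "\<exists>v. (\<forall>n. finite (v n) \<and> v n \<subseteq> u n) \<and> E \<subseteq> (\<Union>n. \<Union>(v n))"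
proof (cases "E = {}")
  case True
  then show ?thesis
    by (intro exI[of _ "\<lambda>_. {}"]) auto
next
  case False
  \<comment> \<open>\<open>E\<close> is enumerated, with repetitions if it is finite; the
    \<open>n\<close>-th cover only has to take care of the \<open>n\<close>-th point.\<close>
  have "from_nat_into E n \<in> \<Union>(u n)" for n
    using assms(1)[of n] assms(3) from_nat_into[OF False, of n] by (auto simp: open_cover_def)
  then have "\<forall>n. \<exists>U. U \<in> u n \<and> from_nat_into E n \<in> U"
    by blast
  then obtain U where U: "\<And>n. U n \<in> u n" "\<And>n. from_nat_into E n \<in> U n"
    by metis
  have "x \<in> (\<Union>n. \<Union>{U n})" if "x \<in> E" for x
    using U(2)[of "to_nat_on E x"] from_nat_into_to_nat_on[OF assms(2) that] by auto
  then show ?thesis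
    using U(1) by (intro exI[of _ "\<lambda>n. {U n}"]) auto
qed

text \<open>A Luzin set is exhausted, up to countably many points, by any open set containing a dense
  subset of it.\<close>

lemma Menger_image_Luzin_set:
  assumes f: "borel_map S T f" and S: "second_countable S" and T: "second_countable T"
    and L: "L \<subseteq> topspace S"
    and Luzin: "\<And>N. nowhere_dense_in S N \<Longrightarrow> countable (L \<inter> N)"
  shows "Menger_space (subtopology T (f ` L))"
  unfolding Menger_space_def
proof (intro allI impI)
  let ?X = "subtopology T (f ` L)"
  fix u :: "nat \<Rightarrow> 'b set set"
  assume u: "\<forall>n. open_cover ?X (u n)"
  have X: "topspace ?X = f ` L"
    using borel_map_topspace[OF f] L by auto
  obtain D where D: "D \<subseteq> topspace S" "meager_in S (topspace S - D)"
    and cont: "continuous_map (subtopology S D) T f"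
    by (rule borel_map_continuous_on_comeager[OF f T])
  obtain \<N> where \<N>: "countable \<N>" "\<And>N. N \<in> \<N> \<Longrightarrow> nowhere_dense_in S N" "topspace S - D = \<Union>\<N>"
    using D(2) by (auto simp: meager_in_def)
  have "L - D = (\<Union>N\<in>\<N>. L \<inter> N)"
    using L \<N>(3) by blast
  then have LD: "countable (L - D)"
    by (simp only:) (intro countable_UN \<N>(1) Luzin \<N>(2))
  \<comment> \<open>\<open>Y\<close> is the part of \<open>L\<close> on which \<open>f\<close> is
    continuous. The rest is countable, since a Luzin set meets each of the countably many nowhere
    dense sets in \<open>\<N>\<close> countably often.\<close>
  define Y where "Y = L \<inter> D"
  have Y: "Y \<subseteq> topspace S"
    using L by (auto simp: Y_def)
  have "separable_space (subtopology S Y)"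
    by (intro second_countable_imp_separable_space second_countable_subtopology S)
  then obtain Q where Q: "countable Q" "Q \<subseteq> Y" "Y \<subseteq> S closure_of Q"
    using Y closure_of_subtopology_subset[of S Y]
    unfolding separable_space_def topspace_subtopology by (metis Int_absorb1 Int_subset_iff)
  have "f ` Q \<subseteq> topspace ?X"
    using Q(2) unfolding X Y_def by blast
  \<comment> \<open>The covers with even index are spent on the image of the countable dense set
    \<open>Q\<close>; those with odd index are kept for the points that remain.\<close>
  from countable_subset_covered[of ?X "\<lambda>n. u (2 * n)", OF u[rule_format] countable_image[OF Q(1)] this]
  obtain v where
    v: "\<And>n. finite (v n) \<and> v n \<subseteq> u (2 * n)" "f ` Q \<subseteq> (\<Union>n. \<Union>(v n))"
    by blast
  define G where "G = (\<Union>n. \<Union>(v n))"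
  have "openin ?X G"
    unfolding G_def
  proof (intro openin_Union ballI)
    fix V assume "V \<in> range (\<lambda>n. \<Union>(v n))"
    then obtain n where V: "V = \<Union>(v n)"
      by blast
    have "\<forall>W\<in>v n. openin ?X W"
      using v(1)[of n] u[rule_format, of "2 * n"] unfolding open_cover_def by blast
    then show "openin ?X V"
      unfolding V by (intro openin_Union) blast
  qed
  then obtain G' where G': "openin T G'" "G = G' \<inter> f ` L"
    by (auto simp: openin_subtopology)
  \<comment> \<open>Continuity on \<open>D\<close> pulls the covered open set \<open>G\<close> back
    to the trace of an open \<open>U\<close> of \<open>S\<close>, so on \<open>Y\<close> lying in
    \<open>U\<close> means being mapped into \<open>G\<close>.\<close>
  have "openin (subtopology S D) {x \<in> topspace (subtopology S D). f x \<in> G'}"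
    using cont G'(1) by (simp add: continuous_map_def)
  then obtain U where U: "openin S U" "{x \<in> topspace (subtopology S D). f x \<in> G'} = U \<inter> D"
    by (auto simp: openin_subtopology)
  have *: "x \<in> U \<longleftrightarrow> f x \<in> G" if "x \<in> Y" for x
  proof -
    have "x \<in> topspace (subtopology S D)" "x \<in> D" "x \<in> L"
      using that Y unfolding Y_def by auto
    moreover have "x \<in> {x \<in> topspace (subtopology S D). f x \<in> G'} \<longleftrightarrow> x \<in> U \<inter> D"
      by (simp only: U(2))
    ultimately show ?thesis
      unfolding G'(2) by blast
  qed
  have "nowhere_dense_in S (S closure_of Q - U)"
  proof (rule nowhere_dense_in_closure_minus_open[OF U(1)])
    show "Q \<subseteq> U"
    proof
      fix q assume "q \<in> Q"
      then have "f q \<in> G" "q \<in> Y"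
        using v(2) Q(2) unfolding G_def[symmetric] by auto
      then show "q \<in> U"
        using * by simp
    qed
  qed
  then have "countable (L \<inter> (S closure_of Q - U))"
    by (rule Luzin)
  \<comment> \<open>By density of \<open>Q\<close> in \<open>Y\<close>, the points of
    \<open>Y\<close> not yet covered lie in a nowhere dense set, so there are only countably
    many.\<close>
  moreover have "Y - U \<subseteq> L \<inter> (S closure_of Q - U)"
    using Q(3) by (auto simp: Y_def)
  ultimately have "countable (Y - U)"
    by (rule countable_subset[rotated])
  then have "countable (f ` ((Y - U) \<union> (L - D)))"
    using LD by simp
  moreover have "f ` ((Y - U) \<union> (L - D)) \<subseteq> topspace ?X"
    unfolding X Y_def by blast
  ultimately have "\<exists>w. (\<forall>n. finite (w n) \<and> w n \<subseteq> u (2 * n + 1)) \<and>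
      f ` ((Y - U) \<union> (L - D)) \<subseteq> (\<Union>n. \<Union>(w n))"
    by (rule countable_subset_covered[OF u[rule_format]])
  then obtain w where
    w: "\<And>n. finite (w n) \<and> w n \<subseteq> u (2 * n + 1)" "f ` ((Y - U) \<union> (L - D)) \<subseteq> (\<Union>n. \<Union>(w n))"
    by blast
  \<comment> \<open>Interleaving the two selections gives one selection from the original sequence
    of covers.\<close>
  define vw where "vw n = (if even n then v (n div 2) else w (n div 2))" for n
  have fin: "finite (vw n) \<and> vw n \<subseteq> u n" for n
    using v(1)[of "n div 2"] w(1)[of "n div 2"] by (auto simp: vw_def)
  have sub: "v n = vw (2 * n)" "w n = vw (2 * n + 1)" for n
    by (auto simp: vw_def)
  have "f ` L \<subseteq> G \<union> f ` ((Y - U) \<union> (L - D))"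
    using *[THEN iffD1] unfolding Y_def by blast
  also have "\<dots> \<subseteq> (\<Union>n. \<Union>(vw n))"
  proof (rule Un_least)
    show "G \<subseteq> (\<Union>n. \<Union>(vw n))"
      unfolding G_def sub(1) by blast
    show "f ` ((Y - U) \<union> (L - D)) \<subseteq> (\<Union>n. \<Union>(vw n))"
      by (rule order_trans[OF w(2)]) (unfold sub(2), blast)
  qed
  finally have "f ` L \<subseteq> (\<Union>n. \<Union>(vw n))" .
  moreover have "(\<Union>n. \<Union>(vw n)) \<subseteq> topspace ?X"
  proof (intro UN_least)
    fix n
    show "\<Union>(vw n) \<subseteq> topspace ?X"
      using fin[of n] u[rule_format, of n] unfolding open_cover_def by blast
  qed
  ultimately show "\<exists>v. (\<forall>n. finite (v n) \<and> v n \<subseteq> u n) \<and> (\<Union>n. \<Union>(v n)) = topspace ?X"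
    using fin unfolding X by (intro exI[of _ vw] conjI allI subset_antisym) auto
qed

section \<open>Generating Luzin sets\<close>

text \<open>\<open>R\<close> is the cardinal well-order of the reals. Its proper initial segments
  have cardinality below the continuum, so they are countable under the Continuum
  Hypothesis.\<close>

lemma continuum_hypothesis_order:
  assumes continuum_hypothesis
  obtains R :: "real \<Rightarrow> real \<Rightarrow> bool"
  where "\<And>a b. R a b \<or> R b a" "\<And>a. countable {b. R b a}"
proof
  let ?r = "card_of (UNIV :: real set)"
  have wo: "Well_order ?r" and F: "Field ?r = UNIV"
    by (rule card_of_Well_order) (simp add: Field_card_of)
  have lin: "total ?r" "refl ?r"
    using wo unfolding well_order_on_def linear_order_on_def partial_order_on_def preorder_on_def F
    by auto
  show "(a, b) \<in> ?r \<or> (b, a) \<in> ?r" for a b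
    using lin(1)[unfolded total_on_def, rule_format, of a b] refl_onD[OF lin(2), of a] by (cases "a = b") auto
  have "countable (underS ?r a)" for a
  proof (rule ccontr)
    assume "uncountable (underS ?r a)"
    then have "underS ?r a \<approx> (UNIV :: real set)"
      using assms by (auto simp: continuum_hypothesis_def)
    then have "(card_of (underS ?r a), ?r) \<in> ordIso"
      by (simp add: eqpoll_iff_card_of_ordIso)
    moreover have "(card_of (underS ?r a), ?r) \<in> ordLess"
      by (rule card_of_underS[OF card_of_Card_order]) (simp add: F)
    ultimately show False
      using not_ordLess_ordIso by blast
  qed
  then have "countable (insert a (underS ?r a))" for a
    by simp
  moreover have "{b. (b, a) \<in> ?r} \<subseteq> insert a (underS ?r a)" for a
    by (auto simp: underS_def)
  ultimately show "countable {b. (b, a) \<in> ?r}" for a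
    by (metis countable_subset)
qed

text \<open>An open set is the union of the basic sets inside it, so it is determined by the set of
  their indices, a set of naturals; there are continuum many of those.\<close>

lemma second_countable_openin_lepoll_reals:
  assumes "second_countable T"
  shows "{U. openin T U} \<lesssim> (UNIV :: real set)"
proof -
  obtain \<B> where \<B>: "countable \<B>" "\<And>V. V \<in> \<B> \<Longrightarrow> openin T V"
    and base: "\<And>U x. openin T U \<Longrightarrow> x \<in> U \<Longrightarrow> \<exists>V\<in>\<B>. x \<in> V \<and> V \<subseteq> U"
    using assms unfolding second_countable_def by metis
  have "inj_on (\<lambda>U. to_nat_on \<B> ` {V \<in> \<B>. V \<subseteq> U}) {U. openin T U}"
  proof (rule inj_onI)
    fix U W assume UW: "U \<in> {U. openin T U}" "W \<in> {U. openin T U}"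
      "to_nat_on \<B> ` {V \<in> \<B>. V \<subseteq> U} = to_nat_on \<B> ` {V \<in> \<B>. V \<subseteq> W}"
    have "{V \<in> \<B>. V \<subseteq> U} = {V \<in> \<B>. V \<subseteq> W}"
      using UW(3) by (subst (asm) inj_on_image_eq_iff[OF inj_on_to_nat_on[OF \<B>(1)]]) auto
    moreover have "U = \<Union>{V \<in> \<B>. V \<subseteq> U}" "W = \<Union>{V \<in> \<B>. V \<subseteq> W}"
      using base UW(1,2) by blast+
    ultimately show "U = W"
      by simp
  qed
  then have "{U. openin T U} \<lesssim> (UNIV :: nat set set)"
    unfolding lepoll_def by blast
  then show ?thesis
    using nat_sets_eqpoll_reals lepoll_trans2 by blast
qed

text \<open>Coding a point by the open complement of its singleton lets the bound on the number of
  open sets bound the number of points too.\<close>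

lemma t1_topspace_lepoll_openin:
  assumes "t1_space T"
  shows "topspace T \<lesssim> {U. openin T U}"
  unfolding lepoll_def
proof (intro exI conjI)
  show "inj_on (\<lambda>x. topspace T - {x}) (topspace T)"
    by (rule inj_onI) blast
  show "(\<lambda>x. topspace T - {x}) ` topspace T \<subseteq> {U. openin T U}"
    using assms by (auto simp: t1_space_closedin_singleton closedin_def)
qed

text \<open>The inverse map is \<open>y \<mapsto> inv y \<otimes> c\<close>. This transfers
  meagerness between the two factors of a product with value \<open>c\<close>.\<close>

lemma topological_group_homeomorphic_map_mult_inv:
  assumes "topological_group G T" "c \<in> carrier G"
  shows "homeomorphic_map T T (\<lambda>x. c \<otimes>\<^bsub>G\<^esub> inv\<^bsub>G\<^esub> x)"
proof -
  interpret group G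
    using assms(1) by (simp add: topological_group_def)
  have top: "topspace T = carrier G"
    and mult: "continuous_map (prod_topology T T) T (\<lambda>(x, y). x \<otimes>\<^bsub>G\<^esub> y)"
    and inv: "continuous_map T T (\<lambda>x. inv\<^bsub>G\<^esub> x)"
    using assms(1) by (auto simp: topological_group_def)
  have "continuous_map T (prod_topology T T) (\<lambda>x. (c, inv\<^bsub>G\<^esub> x))"
    using inv assms(2) top by (simp add: continuous_map_pairedI)
  from continuous_map_compose[OF this mult]
  have 1: "continuous_map T T (\<lambda>x. c \<otimes>\<^bsub>G\<^esub> inv\<^bsub>G\<^esub> x)"
    by (simp add: o_def)
  have "continuous_map T (prod_topology T T) (\<lambda>x. (inv\<^bsub>G\<^esub> x, c))"
    using inv assms(2) top by (simp add: continuous_map_pairedI)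
  from continuous_map_compose[OF this mult]
  have 2: "continuous_map T T (\<lambda>x. inv\<^bsub>G\<^esub> x \<otimes>\<^bsub>G\<^esub> c)"
    by (simp add: o_def)
  have "homeomorphic_maps T T (\<lambda>x. c \<otimes>\<^bsub>G\<^esub> inv\<^bsub>G\<^esub> x) (\<lambda>x. inv\<^bsub>G\<^esub> x \<otimes>\<^bsub>G\<^esub> c)"
    unfolding homeomorphic_maps_def
    using 1 2 assms(2) by (auto simp: top inv_mult_group m_assoc[symmetric] m_assoc)
  then show ?thesis
    by (rule homeomorphic_maps_map[THEN iffD1, THEN conjunct1])
qed

text \<open>The set \<open>M a\<close> to be avoided at stage \<open>a\<close> depends only on the
  listing, not on earlier choices, so the points are obtained by plain choice, without transfinite
  recursion.\<close>

lemma continuum_hypothesis_generating_Luzin_set: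
  assumes CH: continuum_hypothesis
    and G: "topological_group G T" and T: "second_countable T" "t1_space T"
    and nonmeager: "\<not> meager_in T (topspace T)"
  obtains L where "L \<subseteq> carrier G" "generate G L = carrier G"
    "\<And>N. nowhere_dense_in T N \<Longrightarrow> countable (L \<inter> N)"
proof -
  interpret group G
    using G by (simp add: topological_group_def)
  have top: "topspace T = carrier G"
    using G by (simp add: topological_group_def)
  obtain R :: "real \<Rightarrow> real \<Rightarrow> bool"
    where R: "\<And>a b. R a b \<or> R b a" "\<And>a. countable {b. R b a}"
    using continuum_hypothesis_order[OF CH] by metis
  have opens: "{U. openin T U} \<lesssim> (UNIV :: real set)"
    by (rule second_countable_openin_lepoll_reals[OF T(1)])
  then obtain g :: "real \<Rightarrow> 'a set" where g: "{U. openin T U} \<subseteq> range g"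
    unfolding lepoll_iff by blast
  obtain p :: "real \<Rightarrow> 'a" where p: "carrier G \<subseteq> range p"
    using lepoll_trans[OF t1_topspace_lepoll_openin[OF T(2)] opens]
    unfolding lepoll_iff top by blast
  \<comment> \<open>As \<open>g\<close> reaches every open set, \<open>K\<close> lists all closed
    nowhere dense sets. The default \<open>{}\<close> makes every \<open>K b\<close> nowhere dense,
    so that each \<open>M a\<close>, a countable union, is meager.\<close>
  define K where "K b = (if nowhere_dense_in T (topspace T - g b) then topspace T - g b else {})" for b
  define M where "M a = (\<Union>b\<in>{b. R b a}. K b)" for a
  have "nowhere_dense_in T (K b)" for b
    by (simp add: K_def nowhere_dense_in_empty)
  then have M: "meager_in T (M a)" for a
    unfolding M_def using R(2) by (intro meager_in_UN nowhere_dense_imp_meager_in)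
  have "\<exists>x\<in>carrier G. x \<notin> M a \<and> (p a \<in> carrier G \<longrightarrow> inv\<^bsub>G\<^esub> x \<otimes>\<^bsub>G\<^esub> p a \<notin> M a)" for a
  proof (cases "p a \<in> carrier G")
    case True
    let ?h = "\<lambda>x. p a \<otimes>\<^bsub>G\<^esub> inv\<^bsub>G\<^esub> x"
    have "meager_in T (M a \<union> ?h ` M a)"
      by (intro meager_in_Un M meager_in_homeomorphic_image[OF
          topological_group_homeomorphic_map_mult_inv[OF G True]])
    then have "\<not> carrier G \<subseteq> M a \<union> ?h ` M a"
      using nonmeager meager_in_subset top by metis
    then obtain x where x: "x \<in> carrier G" "x \<notin> M a" "x \<notin> ?h ` M a"
      by blast
    have "x = ?h (inv\<^bsub>G\<^esub> x \<otimes>\<^bsub>G\<^esub> p a)"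
      using x(1) True by (simp add: inv_mult_group m_assoc[symmetric])
    then show ?thesis
      using x by blast
  next
    case False
    have "\<not> carrier G \<subseteq> M a"
      using nonmeager meager_in_subset[OF M] top by metis
    then show ?thesis
      using False by blast
  qed
  then obtain x where x: "\<And>a. x a \<in> carrier G" "\<And>a. x a \<notin> M a"
      "\<And>a. p a \<in> carrier G \<Longrightarrow> inv\<^bsub>G\<^esub> (x a) \<otimes>\<^bsub>G\<^esub> p a \<notin> M a"
    by metis
  define y where "y a = inv\<^bsub>G\<^esub> (x a) \<otimes>\<^bsub>G\<^esub> p a" for a
  define L where "L = range x \<union> y ` {a. p a \<in> carrier G}"
  have L: "L \<subseteq> carrier G"
    using x(1) by (auto simp: L_def y_def)
  show ?thesis
  proof
    show "L \<subseteq> carrier G"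
      by (rule L)
    show "generate G L = carrier G"
    proof
      show "generate G L \<subseteq> carrier G"
        using L by (rule generate_incl)
      show "carrier G \<subseteq> generate G L"
      proof
        fix c assume c: "c \<in> carrier G"
        then obtain a where a: "c = p a"
          using p by blast
        have "x a \<in> generate G L" "y a \<in> generate G L"
          using c a by (auto simp: L_def intro!: generate.incl)
        then have "x a \<otimes>\<^bsub>G\<^esub> y a \<in> generate G L"
          by (rule generate.eng)
        \<comment> \<open>Both factors of \<open>c = p a\<close> were put into \<open>L\<close> at
          stage \<open>a\<close>.\<close>
        moreover have "x a \<otimes>\<^bsub>G\<^esub> y a = c"
          using c a x(1)[of a] by (simp add: y_def m_assoc[symmetric])
        ultimately show "c \<in> generate G L"
          by simp
      qed
    qed
    fix N assume N: "nowhere_dense_in T N"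
    have "openin T (topspace T - T closure_of N)"
      by (simp add: openin_diff)
    then have "topspace T - T closure_of N \<in> range g"
      using g by blast
    then obtain b where b: "topspace T - T closure_of N = g b"
      by blast
    have "topspace T - g b = T closure_of N"
      using b closure_of_subset_topspace[of T N] by blast
    then have K: "K b = T closure_of N"
      using nowhere_dense_in_closure[OF N] by (simp add: K_def)
    have "N \<subseteq> T closure_of N"
      using N by (simp add: nowhere_dense_in_def closure_of_subset)
    have "L \<inter> N \<subseteq> x ` {a. R a b} \<union> y ` {a. R a b}"
    proof
      fix z assume z: "z \<in> L \<inter> N"
      then have zK: "z \<in> K b"
        using \<open>N \<subseteq> T closure_of N\<close> K by blast
      \<comment> \<open>If \<open>R b a\<close> held, then \<open>K b \<subseteq> M a\<close> would
        contain \<open>z\<close>. So a point of \<open>K b\<close> can only be chosen at one of the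
        countably many stages \<open>a\<close> with \<open>R a b\<close>.\<close>
      have "R a b" if "z \<notin> M a" for a
        using that zK R(1)[of a b] by (auto simp: M_def)
      then show "z \<in> x ` {a. R a b} \<union> y ` {a. R a b}"
        using z x(2,3) unfolding L_def y_def by blast
    qed
    then show "countable (L \<inter> N)"
      by (rule countable_subset) (intro countable_Un countable_image R(2))
  qed
qed

text \<open>The witness is the image of a generating Luzin set of \<open>C\<close>: an epimorphism
  carries generating sets to generating sets, and the Borel map makes the image Menger.\<close>

proposition continuum_hypothesis_generating_Menger_subspace:
  assumes CH: continuum_hypothesis
    and B: "group B" "topspace TB = carrier B" "second_countable TB"
    and C: "topological_group C TC" "metrizable_space TC" "second_countable TC"
    and nonmeager: "\<not> meager_in TC (topspace TC)"
    and f: "f \<in> epi C B" "borel_map TC TB f"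
  shows "\<exists>X \<subseteq> carrier B. Menger_space (subtopology TB X) \<and> generate B X = carrier B"
proof -
  have "t1_space TC"
    using C(2) by (simp add: metrizable_imp_Hausdorff_space Hausdorff_imp_t1_space)
  then obtain L where L: "L \<subseteq> carrier C" "generate C L = carrier C"
    and Luzin: "\<And>N. nowhere_dense_in TC N \<Longrightarrow> countable (L \<inter> N)"
    using continuum_hypothesis_generating_Luzin_set[OF CH C(1,3) _ nonmeager] by metis
  have gC: "group C" and topC: "topspace TC = carrier C"
    using C(1) by (auto simp: topological_group_def)
  have hom: "f \<in> hom C B" and img: "f ` carrier C = carrier B"
    using f(1) by (auto simp: epi_def)
  interpret group_hom C B f
    using gC B(1) hom by (simp add: group_hom_def group_hom_axioms_def)
  show ?thesis
  proof (intro exI[of _ "f ` L"] conjI)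
    show "f ` L \<subseteq> carrier B"
      using L(1) img by blast
    show "Menger_space (subtopology TB (f ` L))"
      using L(1) topC by (intro Menger_image_Luzin_set[OF f(2) C(3) B(3) _ Luzin]) auto
    show "generate B (f ` L) = carrier B"
      using generate_img[OF L(1)] L(2) img by simp
  qed
qed

section \<open>The group of matrices with finite columns\<close>

text \<open>A finite column is encoded by the natural number whose binary digits are its entries.
  The discrete topology on columns refines the subspace topology, and the resulting product is
  completely metrizable.\<close>

definition xor_sequence_group :: "(nat \<Rightarrow> nat) monoid" where
  "xor_sequence_group = \<lparr>carrier = UNIV, mult = (\<lambda>x y j. xor (x j) (y j)), one = (\<lambda>_. 0)\<rparr>"

text \<open>This is the Baire space.\<close>

definition sequence_topology :: "(nat \<Rightarrow> nat) topology" where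
  "sequence_topology = product_topology (\<lambda>_. discrete_topology UNIV) UNIV"

definition column_matrix :: "(nat \<Rightarrow> nat) \<Rightarrow> nat \<times> nat \<Rightarrow> int" where
  "column_matrix x = (\<lambda>(i, j). of_bool (bit (x j) i))"

lemma group_xor_sequence_group: "group xor_sequence_group"
proof (rule groupI)
  fix x assume "x \<in> carrier xor_sequence_group"
  show "\<exists>y\<in>carrier xor_sequence_group.
      y \<otimes>\<^bsub>xor_sequence_group\<^esub> x = \<one>\<^bsub>xor_sequence_group\<^esub>"
    by (rule bexI[of _ x]) (simp_all add: xor_sequence_group_def)
qed (simp_all add: xor_sequence_group_def ac_simps)

lemma inv_xor_sequence_group: "m_inv xor_sequence_group = (\<lambda>x. x)"
proof
  fix x show "inv\<^bsub>xor_sequence_group\<^esub> x = x"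
    using group.inv_equality[OF group_xor_sequence_group, of x x]
    by (simp add: xor_sequence_group_def)
qed

lemma topspace_sequence_topology: "topspace sequence_topology = UNIV"
  by (simp add: sequence_topology_def)

lemma continuous_map_sequence_topology_discrete:
  assumes "h \<in> UNIV \<rightarrow> topspace Y"
  shows "continuous_map sequence_topology Y (\<lambda>x. h (x j))"
  unfolding sequence_topology_def
  using continuous_map_compose[OF continuous_map_product_projection[of j UNIV "\<lambda>_. discrete_topology UNIV"], of Y h] assms
  by (simp add: o_def)

lemma topological_group_xor_sequence_group:
  "topological_group xor_sequence_group sequence_topology"
  unfolding topological_group_def
proof (intro conjI)
  let ?T = sequence_topology
  have proj: "continuous_map ?T (discrete_topology UNIV) (\<lambda>x. x j)" for j
    using continuous_map_sequence_topology_discrete[of id "discrete_topology UNIV" j] by simp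
  have "continuous_map (prod_topology ?T ?T) (discrete_topology UNIV) (\<lambda>z. xor (fst z j) (snd z j))" for j
  proof -
    have "continuous_map (prod_topology ?T ?T)
        (prod_topology (discrete_topology UNIV) (discrete_topology UNIV)) (\<lambda>z. (fst z j, snd z j))"
      using continuous_map_compose[OF continuous_map_fst proj[of j]]
        continuous_map_compose[OF continuous_map_snd proj[of j]]
      by (intro continuous_map_pairedI) (simp_all add: o_def)
    \<comment> \<open>The product of two discrete spaces is discrete, so \<open>xor\<close> is
      continuous on it.\<close>
    from continuous_map_compose[OF this, of "discrete_topology UNIV" "\<lambda>(a, b). xor a b"]
    show ?thesis
      by (simp add: o_def case_prod_unfold prod_topology_discrete_topology[symmetric])
  qed
  then have "continuous_map (prod_topology ?T ?T) (product_topology (\<lambda>_. discrete_topology UNIV) UNIV)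
      (\<lambda>z j. xor (fst z j) (snd z j))"
    by (simp add: continuous_map_componentwise_UNIV)
  then show "continuous_map (prod_topology ?T ?T) ?T (\<lambda>(x, y). x \<otimes>\<^bsub>xor_sequence_group\<^esub> y)"
    by (simp add: xor_sequence_group_def sequence_topology_def case_prod_unfold)
qed (simp_all add: group_xor_sequence_group topspace_sequence_topology inv_xor_sequence_group,
    simp add: xor_sequence_group_def)

lemma completely_metrizable_sequence_topology: "completely_metrizable_space sequence_topology"
  by (simp add: sequence_topology_def completely_metrizable_space_product_topology
      completely_metrizable_space_discrete_topology)

lemma second_countable_euclidean:
  "second_countable (euclidean :: 'a::second_countable_topology topology)"
proof -
  obtain \<B> :: "'a set set" where "countable \<B>" "topological_basis \<B>"
    using ex_countable_basis by blast
  then show ?thesis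
    unfolding second_countable_def
    by (intro exI[of _ \<B>]) (auto simp: topological_basis_open elim!: topological_basisE)
qed

lemma second_countable_sequence_topology: "second_countable sequence_topology"
proof -
  have "discrete_topology (UNIV :: nat set) = euclidean"
    by (simp add: topology_eq open_discrete)
  then show ?thesis
    using second_countable_euclidean
    by (simp add: sequence_topology_def euclidean_product_topology)
qed

lemma column_matrix_nonzero: "{i. column_matrix x (i, j) \<noteq> 0} = {i. bit (x j) i}"
  by (simp add: column_matrix_def)

lemma finite_bits_nat: "finite {i. bit (n::nat) i}"
  using finite_set_decode[of n] by (simp add: set_decode_def bit_iff_odd)

text \<open>Bitwise \<open>xor\<close> is addition modulo 2 of the digits, and a column with finite
  support has the code \<open>set_encode\<close> of that support.\<close>

lemma column_matrix_epi: "column_matrix \<in> epi xor_sequence_group finite_column_group"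
  unfolding epi_iff_subset
proof
  have "column_matrix x \<in> finite_column_matrices" for x
    unfolding finite_column_matrices_def
    by (auto simp: column_matrix_nonzero finite_bits_nat)
       (auto simp: binary_matrix_group_def carrier_integer_mod_group_2 column_matrix_def)
  moreover have "column_matrix (\<lambda>j. xor (x j) (y j)) =
      (\<lambda>p. (column_matrix x p + column_matrix y p) mod 2)" for x y
    by (auto simp: column_matrix_def fun_eq_iff bit_xor_iff)
  ultimately show "column_matrix \<in> hom xor_sequence_group finite_column_group"
    by (simp add: hom_def xor_sequence_group_def finite_column_group_def mult_binary_matrix_group)
  show "carrier finite_column_group \<subseteq> column_matrix ` carrier xor_sequence_group"
  proof
    fix m assume "m \<in> carrier finite_column_group"
    then have m: "\<And>p. m p \<in> {0, 1}" "\<And>j. finite {i. m (i, j) \<noteq> 0}"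
      by (auto simp: finite_column_group_def finite_column_matrices_def binary_matrix_group_def
          carrier_integer_mod_group_2)
    define x where "x j = set_encode {i. m (i, j) \<noteq> 0}" for j
    have "bit (x j) i \<longleftrightarrow> m (i, j) \<noteq> 0" for i j
      using set_encode_inverse[OF m(2)[of j]]
      by (auto simp: x_def set_decode_def bit_iff_odd set_eq_iff)
    then have "m = column_matrix x"
      using m(1) by (fastforce simp: column_matrix_def fun_eq_iff)
    then show "m \<in> column_matrix ` carrier xor_sequence_group"
      by (simp add: xor_sequence_group_def)
  qed
qed

section \<open>Topology of the group of matrices with finite columns\<close>

lemma topspace_finite_column_topology:
  "topspace finite_column_topology = carrier finite_column_group"
  by (auto simp: finite_column_topology_def finite_column_group_def
      topspace_binary_matrix_topology finite_column_matrices_def)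

lemma column_matrix_image:
  "column_matrix ` topspace sequence_topology = topspace finite_column_topology"
  using column_matrix_epi
  by (simp add: epi_def topspace_sequence_topology topspace_finite_column_topology
      xor_sequence_group_def)

text \<open>Each matrix entry depends on a single coordinate of the sequence, which ranges over a
  discrete space.\<close>

lemma continuous_map_column_matrix:
  "continuous_map sequence_topology finite_column_topology column_matrix"
proof -
  have "continuous_map sequence_topology (discrete_topology {0, 1}) (\<lambda>x. column_matrix x p)" for p
  proof (cases p)
    case (Pair i j)
    show ?thesis
      using continuous_map_sequence_topology_discrete
        [of "\<lambda>n. of_bool (bit n i) :: int" "discrete_topology {0, 1}" j]
      by (simp add: Pair column_matrix_def)
  qed
  then have "continuous_map sequence_topology binary_matrix_topology column_matrix"
    by (simp add: binary_matrix_topology_def continuous_map_componentwise_UNIV)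
  moreover have "column_matrix ` topspace sequence_topology \<subseteq> finite_column_matrices"
    using column_matrix_image by (auto simp: topspace_finite_column_topology finite_column_group_def)
  ultimately show ?thesis
    by (auto simp: finite_column_topology_def continuous_map_in_subtopology)
qed

text \<open>Metrizability is inherited from the countable product of discrete spaces, separability
  from the Baire space through the continuous surjection \<open>column_matrix\<close>.\<close>

lemma second_countable_finite_column_topology: "second_countable finite_column_topology"
proof (rule metrizable_separable_imp_second_countable)
  show "metrizable_space finite_column_topology"
    unfolding finite_column_topology_def binary_matrix_topology_def
    by (intro metrizable_space_subtopology) (simp add: metrizable_space_product_topology)
  show "separable_space finite_column_topology"
    using second_countable_imp_separable_space[OF second_countable_sequence_topology]
      continuous_map_column_matrix column_matrix_image
    by (rule separable_space_continuous_map_image)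
qed

theorem proposition6:
  assumes "continuum_hypothesis"
  shows "(\<forall>(B :: 'b monoid) TB.
            topological_group B TB \<and> metrizable_space TB \<and> separable_space TB \<and>
            (\<exists>(C :: 'c monoid) TC f.
               topological_group C TC \<and> metrizable_space TC \<and> separable_space TC \<and>
               \<not> meager_in TC (topspace TC) \<and>
               f \<in> epi C B \<and> borel_map TC TB f) \<longrightarrow>
            (\<exists>X \<subseteq> carrier B. Menger_space (subtopology TB X) \<and> generate B X = carrier B))
       \<and> (\<exists>X \<subseteq> carrier finite_column_group.
            Menger_space (subtopology finite_column_topology X) \<and>
            generate finite_column_group X = carrier finite_column_group)"
proof (intro conjI allI impI)
  fix B :: "'b monoid" and TB
  assume B: "topological_group B TB \<and> metrizable_space TB \<and> separable_space TB \<and>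
            (\<exists>(C :: 'c monoid) TC f.
               topological_group C TC \<and> metrizable_space TC \<and> separable_space TC \<and>
               \<not> meager_in TC (topspace TC) \<and>
               f \<in> epi C B \<and> borel_map TC TB f)"
  then obtain C :: "'c monoid" and TC f where C: "topological_group C TC" "metrizable_space TC"
    "separable_space TC" "\<not> meager_in TC (topspace TC)" "f \<in> epi C B" "borel_map TC TB f"
    by blast
  have "group B" "topspace TB = carrier B" "second_countable TB"
    using B metrizable_separable_imp_second_countable by (auto simp: topological_group_def)
  then show "\<exists>X \<subseteq> carrier B. Menger_space (subtopology TB X) \<and> generate B X = carrier B"
    using C metrizable_separable_imp_second_countable[OF C(2,3)]
    by (intro continuum_hypothesis_generating_Menger_subspace[OF assms])
next
  \<comment> \<open>The types of the first claim are fixed here, so the second claim is an instance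
    of the general proposition, with \<open>C\<close> the group of sequences under
    \<open>xor\<close>, nonmeager by the Baire category theorem.\<close>
  have "group finite_column_group"
    unfolding finite_column_group_def
    using group.subgroup_imp_group[OF group_binary_matrix_group subgroup_finite_column_matrices] .
  moreover have "\<not> meager_in sequence_topology (topspace sequence_topology)"
    by (intro completely_metrizable_nonmeager completely_metrizable_sequence_topology)
      (simp add: topspace_sequence_topology)
  ultimately show "\<exists>X \<subseteq> carrier finite_column_group.
            Menger_space (subtopology finite_column_topology X) \<and>
            generate finite_column_group X = carrier finite_column_group"
    using continuous_map_imp_borel_map[OF continuous_map_column_matrix]
    by (intro continuum_hypothesis_generating_Menger_subspace[OF assms _ topspace_finite_column_topology
          second_countable_finite_column_topology topological_group_xor_sequence_group
          completely_metrizable_imp_metrizable_space[OF completely_metrizable_sequence_topology]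
          second_countable_sequence_topology _ column_matrix_epi])
qed

end
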